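(* (In $\mathsf{ZFC}$) There exists a Hausdorff topological space which is Fréchet, sequentially compact, and not $2$-sequentially compact.
   Context: $[B]^n$ denotes the set of all subsets of $B$ of cardinality $n$ and $[B]^\omega$ the set of all countably infinite subsets of $B$. For a topological space $X$, a countable set $B$, $n\ge 1$, a function $f:[B]^n\to X$ and $p\in X$, $f$ converges to $p$ if for every neighborhood $U$ of $p$ there is a finite $F\subseteq B$ with $f''[B\setminus F]^n\subseteq U$ (where $f''S=\{f(x):x\in S\}$); $f$ is convergent if it converges to some $p\in X$. The space $X$ is $n$-sequentially compact if for every $f:[\omega]^n\to X$ there is $B\in[\omega]^\omega$ such that $f\restriction[B]^n$ is convergent. ($1$-sequential compactness is the usual sequential compactness.) A space $X$ is Fréchet if whenever $A\subseteq X$ and $x\in\overline A$ there is a sequence of points of $A$ converging to $x$. *)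

theory Defs
  imports "HOL-Analysis.Analysis" "HOL-Library.Ramsey"
begin

definition frechet_space :: "'a topology \<Rightarrow> bool" where
  "frechet_space X \<longleftrightarrow>
     (\<forall>A x. A \<subseteq> topspace X \<and> x \<in> X closure_of A \<longrightarrow>
        (\<exists>s::nat \<Rightarrow> 'a. range s \<subseteq> A \<and> limitin X s x sequentially))"

definition seq_compact_space :: "'a topology \<Rightarrow> bool" where
  "seq_compact_space X \<longleftrightarrow>
     (\<forall>s::nat \<Rightarrow> 'a. range s \<subseteq> topspace X \<longrightarrow>
        (\<exists>p r. strict_mono (r::nat \<Rightarrow> nat) \<and> limitin X (s \<circ> r) p sequentially))"

text \<open>The notation \<open>[B]\<^bsup>n\<^esup>\<close> is \<^const>\<open>nsets\<close> of \<^theory>\<open>HOL-Library.Ramsey\<close>: the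
  subsets of \<open>B\<close> with exactly \<open>n\<close> elements. Only the values of \<open>f\<close> on \<open>[B]\<^bsup>n\<^esup>\<close> matter below, so
  no restriction operator is needed for functions given on a larger \<open>[A]\<^bsup>n\<^esup>\<close>. As in
  \<^const>\<open>limitin\<close>, neighbourhoods are taken to be open. The notions are intended for \<open>n \<ge> 1\<close>
  and countable \<open>B\<close>.\<close>

definition nsets_converges_to ::
    "'a topology \<Rightarrow> nat \<Rightarrow> 'b set \<Rightarrow> ('b set \<Rightarrow> 'a) \<Rightarrow> 'a \<Rightarrow> bool" where
  "nsets_converges_to X n B f p \<longleftrightarrow>
     p \<in> topspace X \<and>
     (\<forall>U. openin X U \<and> p \<in> U \<longrightarrow> (\<exists>F. finite F \<and> F \<subseteq> B \<and> f ` [B - F]\<^bsup>n\<^esup> \<subseteq> U))"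

definition nsets_convergent ::
    "'a topology \<Rightarrow> nat \<Rightarrow> 'b set \<Rightarrow> ('b set \<Rightarrow> 'a) \<Rightarrow> bool" where
  "nsets_convergent X n B f \<longleftrightarrow> (\<exists>p. nsets_converges_to X n B f p)"

definition n_seq_compact_space :: "nat \<Rightarrow> 'a topology \<Rightarrow> bool" where
  "n_seq_compact_space n X \<longleftrightarrow>
     (\<forall>f. f \<in> [UNIV :: nat set]\<^bsup>n\<^esup> \<rightarrow> topspace X \<longrightarrow>
        (\<exists>B. infinite B \<and> nsets_convergent X n B f))"

lemma image_nsets_1: "f ` [A]\<^bsup>1\<^esup> = (\<lambda>i. f {i}) ` A"
  by (auto simp: nsets_def card_1_singleton_iff)

lemma nsets_converges_to_1_range:
  fixes r :: "nat \<Rightarrow> nat"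
  assumes r: "strict_mono r"
  shows "nsets_converges_to X 1 (range r) f p \<longleftrightarrow> limitin X (\<lambda>k. f {r k}) p sequentially"
proof -
  have inj: "inj r"
    using r by (rule strict_mono_imp_inj_on)
  have "(\<exists>F. finite F \<and> F \<subseteq> range r \<and> (\<lambda>i. f {i}) ` (range r - F) \<subseteq> U) \<longleftrightarrow>
        eventually (\<lambda>k. f {r k} \<in> U) sequentially" for U
  proof
    assume "\<exists>F. finite F \<and> F \<subseteq> range r \<and> (\<lambda>i. f {i}) ` (range r - F) \<subseteq> U"
    then obtain F where F: "finite F" "(\<lambda>i. f {i}) ` (range r - F) \<subseteq> U"
      by blast
    have "finite {k. f {r k} \<notin> U}"
      by (rule finite_subset[OF _ finite_vimageI[OF F(1) inj]]) (use F(2) in blast)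
    then show "eventually (\<lambda>k. f {r k} \<in> U) sequentially"
      by (simp add: cofinite_eq_sequentially[symmetric] eventually_cofinite)
  next
    assume "eventually (\<lambda>k. f {r k} \<in> U) sequentially"
    then have "finite {k. f {r k} \<notin> U}"
      by (simp add: cofinite_eq_sequentially[symmetric] eventually_cofinite)
    then show "\<exists>F. finite F \<and> F \<subseteq> range r \<and> (\<lambda>i. f {i}) ` (range r - F) \<subseteq> U"
      by (intro exI[of _ "r ` {k. f {r k} \<notin> U}"]) auto
  qed
  then show ?thesis
    unfolding nsets_converges_to_def limitin_def image_nsets_1 by blast
qed

lemma n_seq_compact_space_1_iff: "n_seq_compact_space 1 X \<longleftrightarrow> seq_compact_space X"
proof
  assume L: "n_seq_compact_space 1 X"
  show "seq_compact_space X"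
    unfolding seq_compact_space_def
  proof (intro allI impI)
    fix s :: "nat \<Rightarrow> 'a"
    assume s: "range s \<subseteq> topspace X"
    have "(\<lambda>e. s (the_elem e)) \<in> [UNIV :: nat set]\<^bsup>1\<^esup> \<rightarrow> topspace X"
      using s by auto
    with L obtain B p where B: "infinite B" "nsets_converges_to X 1 B (\<lambda>e. s (the_elem e)) p"
      unfolding n_seq_compact_space_def nsets_convergent_def by blast
    obtain r :: "nat \<Rightarrow> nat" where r: "strict_mono r" "range r = B"
      using B(1) by (meson infinite_enumerate range_enumerate strict_mono_enumerate)
    then have "limitin X (s \<circ> r) p sequentially"
      using B(2) nsets_converges_to_1_range[of r X "\<lambda>e. s (the_elem e)" p]
      by (simp add: o_def)
    with r show "\<exists>p r. strict_mono (r::nat \<Rightarrow> nat) \<and> limitin X (s \<circ> r) p sequentially"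
      by blast
  qed
next
  assume R: "seq_compact_space X"
  show "n_seq_compact_space 1 X"
    unfolding n_seq_compact_space_def
  proof (intro allI impI)
    fix f :: "nat set \<Rightarrow> 'a"
    assume "f \<in> [UNIV]\<^bsup>1\<^esup> \<rightarrow> topspace X"
    then have "f ` [UNIV]\<^bsup>1\<^esup> \<subseteq> topspace X"
      by blast
    then have "range (\<lambda>i. f {i}) \<subseteq> topspace X"
      unfolding image_nsets_1 .
    with R obtain p r where r: "strict_mono (r::nat \<Rightarrow> nat)"
        "limitin X ((\<lambda>i. f {i}) \<circ> r) p sequentially"
      unfolding seq_compact_space_def by blast
    then have "nsets_converges_to X 1 (range r) f p"
      using nsets_converges_to_1_range[of r X f p] by (simp add: o_def)
    moreover have "infinite (range r)"
      using r(1) by (simp add: range_inj_infinite strict_mono_imp_inj_on)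
    ultimately show "\<exists>B. infinite B \<and> nsets_convergent X 1 B f"
      unfolding nsets_convergent_def by blast
  qed
qed

text \<open>On the carrier type for existence statements: since a type cannot be quantified
  existentially, the witnessing space is sought among the topologies on subsets of
  \<^typ>\<open>nat set\<close>, a type of cardinality continuum. This loses no generality. If \<open>X\<close> is Hausdorff,
  Frechet and sequentially compact and \<open>f\<close> on \<open>[\<omega>]\<^bsup>2\<^esup>\<close> witnesses that \<open>X\<close> is not 2-sequentially
  compact, then the closure of the countable range of \<open>f\<close> is a subspace with the same properties,
  and it has at most continuum many points, because each of them is the unique limit of a
  sequence in a countable set.\<close>

end

theory Submission
  imports Defs
begin

text \<open>
  A family \<open>A\<close> of almost disjoint infinite sets of naturals yields a compact Hausdorff space: the
  one-point compactification of its Mrowka space \<open>\<omega> \<union> A\<close>. It is always sequentially compact, and it is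
  Frechet as soon as every set that is not almost covered by finitely many members of \<open>A\<close> contains
  an infinite set almost disjoint from all of \<open>A\<close>. By an argument of P. Simon, there are a
  maximal almost disjoint family \<open>M\<close>, a partition \<open>M = M\<^sub>0 \<union> M\<^sub>1\<close> and a set \<open>X\<close> meeting
  infinitely many members of \<open>M\<close> in an infinite set, such that neither part is maximal below any
  subset of \<open>X\<close> of this kind: split \<open>M\<close> according to whether \<open>n \<in> a\<close>. If this failed for every
  \<open>n\<close> and \<open>X\<close>, a decreasing sequence of such sets would decide all the bits \<open>n \<in> a\<close>, and a
  pseudo-intersection of it would meet only one member of \<open>M\<close>.

  The space is built from the traces of \<open>M\<^sub>1\<close> on \<open>X\<close>. Choose distinct members \<open>c\<^sub>n\<close> of \<open>M\<close> with
  infinite trace on \<open>X\<close> and map \<open>{n < m}\<close> to the \<open>m\<close>-th point of \<open>c\<^sub>n \<inter> X\<close>. If this converged on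
  \<open>[B]\<^sup>2\<close>, the limit could only be the point at infinity. But then the images of the sets
  \<open>[B - {..n}]\<^sup>2\<close> would have a pseudo-intersection that meets infinitely many members of \<open>M\<close> and is almost
  disjoint from \<open>M\<^sub>1\<close>, and it would contain an infinite set almost disjoint from \<open>M\<^sub>0\<close> as well,
  contradicting maximality.
\<close>

section \<open>Maximal almost disjoint families\<close>

definition almost_disjoint :: "'a set set \<Rightarrow> bool" where
  "almost_disjoint M \<longleftrightarrow> (\<forall>a\<in>M. infinite a) \<and> (\<forall>a\<in>M. \<forall>b\<in>M. a \<noteq> b \<longrightarrow> finite (a \<inter> b))"

definition orthogonal_to :: "'a set set \<Rightarrow> 'a set \<Rightarrow> bool" where
  "orthogonal_to M Z \<longleftrightarrow> (\<forall>a\<in>M. finite (a \<inter> Z))"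

text \<open>For a maximal almost disjoint \<open>M\<close>, having infinitely many traces means
  exactly that \<open>X\<close> is not almost covered by finitely many members of
  \<open>M\<close>.\<close>

definition traces :: "'a set set \<Rightarrow> 'a set \<Rightarrow> 'a set set" where
  "traces M X = {a \<in> M. infinite (a \<inter> X)}"

lemma orthogonal_to_subset: "orthogonal_to M Z \<Longrightarrow> Y \<subseteq> Z \<Longrightarrow> orthogonal_to M Y"
  unfolding orthogonal_to_def by (meson Int_mono finite_subset order_refl)

lemma infinite_remainder: "infinite A \<Longrightarrow> finite C \<Longrightarrow> A \<subseteq> B \<union> C \<Longrightarrow> infinite B"
  by (meson finite_UnI finite_subset)

lemma finite_Int_Union:
  assumes "almost_disjoint M" "a \<in> M" "K \<subseteq> M" "finite K" "a \<notin> K"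
  shows "finite (a \<inter> \<Union>K)"
proof -
  have "finite (a \<inter> b)" if "b \<in> K" for b
  proof -
    have "b \<in> M" "a \<noteq> b"
      using that assms(3,5) by auto
    then show ?thesis
      using assms(1,2) unfolding almost_disjoint_def by simp
  qed
  then show ?thesis
    unfolding Int_Union by (rule finite_UN_I[OF assms(4)])
qed

locale mad_family =
  fixes M :: "nat set set"
  assumes ad: "almost_disjoint M"
    and maximal: "orthogonal_to M Z \<Longrightarrow> finite Z"

text \<open>Zorn's lemma is applied above the columns of a pairing function; this infinite base
  rules out finite maximal families such as \<open>{UNIV}\<close>.\<close>

lemma mad_family_exists: "\<exists>M. mad_family M \<and> infinite M"
proof -
  define base where "base = range (\<lambda>k::nat. range (\<lambda>m::nat. prod_encode (k, m)))"
  have "inj (\<lambda>k::nat. range (\<lambda>m::nat. prod_encode (k, m)))"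
  proof (rule injI)
    fix x y :: nat
    assume "range (\<lambda>m. prod_encode (x, m)) = range (\<lambda>m. prod_encode (y, m))"
    then have "prod_encode (x, 0) \<in> range (\<lambda>m. prod_encode (y, m))"
      by blast
    then show "x = y"
      by auto
  qed
  then have base_inf: "infinite base"
    unfolding base_def by (rule range_inj_infinite)
  have base_ad: "almost_disjoint base"
    unfolding almost_disjoint_def
  proof (intro conjI ballI impI)
    fix a assume "a \<in> base"
    then show "infinite a"
      unfolding base_def by (auto intro!: range_inj_infinite injI)
  next
    fix a b assume "a \<in> base" "b \<in> base" "a \<noteq> b"
    then have "a \<inter> b = {}"
      unfolding base_def by auto
    then show "finite (a \<inter> b)"
      by simp
  qed
  define F where "F = {M. base \<subseteq> M \<and> almost_disjoint M}"
  have "\<exists>M\<in>F. \<forall>N\<in>F. M \<subseteq> N \<longrightarrow> N = M"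
  proof (rule subset_Zorn_nonempty)
    show "F \<noteq> {}"
      using base_ad unfolding F_def by blast
  next
    fix C assume "C \<noteq> {}" and C: "subset.chain F C"
    have CF: "C \<subseteq> F" and lin: "\<And>x y. x \<in> C \<Longrightarrow> y \<in> C \<Longrightarrow> x \<subseteq> y \<or> y \<subseteq> x"
      using C unfolding subset_chain_def by auto
    have CD: "almost_disjoint x" "base \<subseteq> x" if "x \<in> C" for x
      using CF that unfolding F_def by auto
    have "almost_disjoint (\<Union>C)"
      unfolding almost_disjoint_def
    proof (intro conjI ballI impI)
      fix a assume "a \<in> \<Union>C"
      then show "infinite a"
        using CD(1) unfolding almost_disjoint_def by blast
    next
      fix a b assume "a \<in> \<Union>C" "b \<in> \<Union>C" and ne: "a \<noteq> b"
      then obtain x y where xy: "x \<in> C" "y \<in> C" "a \<in> x" "b \<in> y"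
        by blast
      then obtain z where "z \<in> C" "a \<in> z" "b \<in> z"
        using lin[of x y] by blast
      then show "finite (a \<inter> b)"
        using CD(1)[of z] ne unfolding almost_disjoint_def by blast
    qed
    moreover have "base \<subseteq> \<Union>C"
      using \<open>C \<noteq> {}\<close> CD(2) by blast
    ultimately show "\<Union>C \<in> F"
      unfolding F_def by blast
  qed
  then obtain M where M: "M \<in> F" "\<And>N. N \<in> F \<Longrightarrow> M \<subseteq> N \<Longrightarrow> N = M"
    by blast
  have ad: "almost_disjoint M" and "base \<subseteq> M"
    using M(1) unfolding F_def by auto
  have "finite Z" if Z: "orthogonal_to M Z" for Z
  proof (rule ccontr)
    assume inf: "infinite Z"
    have "almost_disjoint (insert Z M)"
      using ad Z inf unfolding almost_disjoint_def orthogonal_to_def by (auto simp: Int_commute)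
    then have "insert Z M = M"
      using M(2)[of "insert Z M"] \<open>base \<subseteq> M\<close> unfolding F_def by auto
    \<comment> \<open>\<open>Z\<close> is now a member of \<open>M\<close>, so its orthogonality
      applies to itself.\<close>
    then have "finite (Z \<inter> Z)"
      using Z unfolding orthogonal_to_def by blast
    then show False
      using inf by simp
  qed
  moreover have "infinite M"
    using base_inf \<open>base \<subseteq> M\<close> by (metis finite_subset)
  ultimately show ?thesis
    using ad by (auto simp: mad_family_def)
qed

section \<open>Pseudo-intersections of decreasing sequences\<close>

text \<open>Diagonal choice of a point \<open>y n\<close> of \<open>X n\<close> beyond
  \<open>n\<close>: the range is unbounded, and only the \<open>y m\<close> with
  \<open>m < n\<close> can lie outside \<open>X n\<close>.\<close>

lemma infinite_pseudo_intersection: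
  fixes X :: "nat \<Rightarrow> nat set"
  assumes dec: "decseq X" and inf: "\<And>n. infinite (X n)"
  shows "\<exists>Y. infinite Y \<and> (\<forall>n. finite (Y - X n))"
proof -
  have "\<forall>n. \<exists>y>n. y \<in> X n"
    using inf infinite_nat_iff_unbounded by blast
  then obtain y where y: "\<And>n. n < y n" "\<And>n. y n \<in> X n"
    by metis
  have "range y - X n \<subseteq> y ` {..<n}" for n
  proof
    fix x assume "x \<in> range y - X n"
    then obtain m where m: "x = y m" "y m \<notin> X n"
      by blast
    then have "\<not> n \<le> m"
      using y(2)[of m] decseqD[OF dec, of n m] by blast
    then show "x \<in> y ` {..<n}"
      using m by auto
  qed
  then have "finite (range y - X n)" for n
    by (meson finite_imageI finite_lessThan finite_subset)
  moreover have "infinite (range y)"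
    using y(1) infinite_nat_iff_unbounded by blast
  ultimately show ?thesis
    by blast
qed

context mad_family
begin

text \<open>Infinitely many members of \<open>M\<close> meet some pseudo-intersection in an infinite
  set, and countably many of these pseudo-intersections can be glued diagonally into one.\<close>

lemma infinite_traces_pseudo_intersection:
  fixes X :: "nat \<Rightarrow> nat set"
  assumes dec: "decseq X" and pos: "\<And>n. infinite (traces M (X n))"
  shows "\<exists>Y. infinite (traces M Y) \<and> (\<forall>n. finite (Y - X n))"
proof -
  define H where "H = {a \<in> M. \<exists>Y. infinite (a \<inter> Y) \<and> (\<forall>n. finite (Y - X n))}"
  have "infinite H"
  proof
    assume fin: "finite H"
    have HM: "H \<subseteq> M"
      unfolding H_def by blast
    \<comment> \<open>A member outside \<open>H\<close> with infinite trace on \<open>X n\<close> is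
      almost disjoint from the finite union of \<open>H\<close>, so removing that union leaves an
      infinite set.\<close>
    have "infinite (X n - \<Union>H)" for n
    proof -
      have "\<not> traces M (X n) \<subseteq> H"
        using pos[of n] fin by (metis finite_subset)
      then obtain a where a: "a \<in> traces M (X n)" "a \<notin> H"
        by blast
      have "infinite (a \<inter> X n)" "finite (a \<inter> \<Union>H)"
        using a finite_Int_Union[OF ad _ HM fin] by (auto simp: traces_def)
      then show ?thesis
        by (rule infinite_remainder) blast
    qed
    moreover have "decseq (\<lambda>n. X n - \<Union>H)"
      using dec unfolding decseq_def by blast
    ultimately obtain Y where Y: "infinite Y" "\<And>n. finite (Y - (X n - \<Union>H))"
      using infinite_pseudo_intersection[of "\<lambda>n. X n - \<Union>H"] by auto
    then obtain a where a: "a \<in> M" "infinite (a \<inter> Y)"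
      using maximal unfolding orthogonal_to_def by blast
    have "finite (Y - X n)" for n
      using Y(2)[of n] by (rule rev_finite_subset) blast
    then have "a \<in> H"
      using a unfolding H_def by blast
    \<comment> \<open>As an element of \<open>H\<close>, \<open>a\<close> is disjoint from
      \<open>X 0 - \<Union>H\<close>, which almost contains \<open>Y\<close>.\<close>
    then have "a \<inter> Y \<subseteq> Y - (X 0 - \<Union>H)"
      by blast
    then show False
      using Y(2) a(2) by (metis finite_subset)
  qed
  then obtain a :: "nat \<Rightarrow> nat set" where a: "inj a" "range a \<subseteq> H"
    using infinite_countable_subset by blast
  then have "\<forall>k. \<exists>Y. infinite (a k \<inter> Y) \<and> (\<forall>n. finite (Y - X n))"
    unfolding H_def by blast
  then obtain Y where Y: "\<And>k. infinite (a k \<inter> Y k)" "\<And>k n. finite (Y k - X n)"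
    by metis
  \<comment> \<open>Intersecting with \<open>X k\<close> keeps the \<open>k\<close>-th piece inside
    \<open>X n\<close> for all \<open>n \<le> k\<close>, so only finitely many pieces leave
    \<open>X n\<close>, each in a finite set.\<close>
  define Z where "Z = (\<Union>k. Y k \<inter> X k)"
  have "infinite (a k \<inter> Z)" for k
    by (rule infinite_remainder[OF Y(1) Y(2)[of k k]]) (auto simp: Z_def)
  then have "range a \<subseteq> traces M Z"
    using a(2) unfolding traces_def H_def by blast
  then have "infinite (traces M Z)"
    using range_inj_infinite[OF a(1)] by (rule infinite_super)
  moreover have "finite (Z - X n)" for n
  proof -
    have "Z - X n \<subseteq> (\<Union>k<n. Y k - X n)"
    proof
      fix x assume "x \<in> Z - X n"
      then obtain k where k: "x \<in> Y k" "x \<in> X k" "x \<notin> X n"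
        unfolding Z_def by blast
      then have "\<not> n \<le> k"
        using decseqD[OF dec, of n k] by blast
      then show "x \<in> (\<Union>k<n. Y k - X n)"
        using k by auto
    qed
    then show ?thesis
      using Y(2) by (meson finite_UN_I finite_lessThan finite_subset)
  qed
  ultimately show ?thesis
    by blast
qed

text \<open>Supplies the two failures of maximality behind the example: that of one half gives the
  Frechet property, that of the other half the divergence on pairs.\<close>

lemma nowhere_maximal_partition:
  assumes "infinite M"
  shows "\<exists>n X. infinite (traces M X) \<and>
           (\<forall>Y i. Y \<subseteq> X \<longrightarrow> infinite (traces M Y) \<longrightarrow>
              (\<exists>Z\<subseteq>Y. infinite Z \<and> orthogonal_to {a \<in> M. (n \<in> a) = i} Z))"
proof (rule ccontr)
  assume neg: "\<not> ?thesis"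
  \<comment> \<open>The half of \<open>M\<close> with value \<open>i\<close> at the bit
    \<open>n\<close> is maximal below \<open>Y\<close>.\<close>
  define decided where "decided n Y i \<longleftrightarrow>
      (\<forall>Z\<subseteq>Y. infinite Z \<longrightarrow> \<not> orthogonal_to {a \<in> M. (n \<in> a) = i} Z)" for n Y i
  have step: "\<exists>Y. infinite (traces M Y) \<and> Y \<subseteq> X \<and> (\<exists>i. decided n Y i)"
    if "infinite (traces M X)" for n X
  proof -
    have "\<not> (\<forall>Y i. Y \<subseteq> X \<longrightarrow> infinite (traces M Y) \<longrightarrow>
              (\<exists>Z\<subseteq>Y. infinite Z \<and> orthogonal_to {a \<in> M. (n \<in> a) = i} Z))"
      using neg that by blast
    then obtain Y i where "Y \<subseteq> X" "infinite (traces M Y)"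
        "\<not> (\<exists>Z\<subseteq>Y. infinite Z \<and> orthogonal_to {a \<in> M. (n \<in> a) = i} Z)"
      by blast
    then show ?thesis
      unfolding decided_def by blast
  qed
  have "traces M UNIV = M"
    using ad unfolding traces_def almost_disjoint_def by auto
  then have "\<exists>X. infinite (traces M X)"
    using assms by metis
  then have "\<exists>X. \<forall>n. infinite (traces M (X n)) \<and> X (Suc n) \<subseteq> X n \<and> (\<exists>i. decided n (X (Suc n)) i)"
    using step by (intro dependent_nat_choice) auto
  then obtain X where X: "\<And>n. infinite (traces M (X n))"
      "\<And>n. X (Suc n) \<subseteq> X n" "\<And>n. \<exists>i. decided n (X (Suc n)) i"
    by blast
  then obtain i where i: "\<And>n. decided n (X (Suc n)) (i n)"
    by metis
  obtain Y where Y: "infinite (traces M Y)" "\<And>n. finite (Y - X n)"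
    using infinite_traces_pseudo_intersection[OF decseq_SucI[of X, OF X(2)] X(1)] by auto
  \<comment> \<open>A member with the other value is almost disjoint from the whole half that is
    maximal below \<open>X (Suc n)\<close>, yet its trace on \<open>Y\<close> lies almost inside
    \<open>X (Suc n)\<close>.\<close>
  have bits: "(n \<in> a) = i n" if a: "a \<in> traces M Y" for a n
  proof (rule ccontr)
    assume ne: "(n \<in> a) \<noteq> i n"
    let ?Z = "a \<inter> Y \<inter> X (Suc n)"
    have "infinite (a \<inter> Y)"
      using a by (simp add: traces_def)
    then have "infinite ?Z"
      by (rule infinite_remainder[OF _ Y(2)[of "Suc n"]]) blast
    moreover have "orthogonal_to {b \<in> M. (n \<in> b) = i n} ?Z"
      unfolding orthogonal_to_def
    proof
      fix b assume b: "b \<in> {b \<in> M. (n \<in> b) = i n}"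
      then have "finite (b \<inter> a)"
        using a ne ad unfolding traces_def almost_disjoint_def by fastforce
      then show "finite (b \<inter> ?Z)"
        by (rule rev_finite_subset) blast
    qed
    ultimately show False
      using i[of n] unfolding decided_def by blast
  qed
  \<comment> \<open>A set of naturals is determined by its bits, so at most one member is
    left.\<close>
  have "traces M Y \<subseteq> {{n. i n}}"
    using bits by auto
  then show False
    using Y(1) by (meson finite.emptyI finite.insertI finite_subset)
qed

end

section \<open>The compactified Mrowka space\<close>

text \<open>The natural number \<open>k\<close> is represented by the singleton \<open>{k}\<close>, a member of the almost disjoint
  family by itself, and the point at infinity by the empty set.\<close>

definition psi_carrier :: "nat set set \<Rightarrow> nat set set" where
  "psi_carrier A = insert {} (range (\<lambda>k. {k}) \<union> A)"

text \<open>Naturals are isolated and carry no condition. The last clause describes complements of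
  compact sets of the Mrowka space; \<open>K\<close> may be larger than the set of missed
  members.\<close>

definition psi_open :: "nat set set \<Rightarrow> nat set set \<Rightarrow> bool" where
  "psi_open A U \<longleftrightarrow> U \<subseteq> psi_carrier A \<and>
     (\<forall>a\<in>A \<inter> U. finite {k \<in> a. {k} \<notin> U}) \<and>
     ({} \<in> U \<longrightarrow> (\<exists>K. finite K \<and> K \<subseteq> A \<and> A - U \<subseteq> K \<and> finite ({k. {k} \<notin> U} - \<Union>K)))"

lemma psi_open_subset: "psi_open A U \<Longrightarrow> U \<subseteq> psi_carrier A"
  unfolding psi_open_def by simp

lemma psi_open_memberD: "psi_open A U \<Longrightarrow> a \<in> A \<Longrightarrow> a \<in> U \<Longrightarrow> finite {k \<in> a. {k} \<notin> U}"
  unfolding psi_open_def by auto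

lemma psi_open_infinityE:
  assumes "psi_open A U" "{} \<in> U"
  obtains K where "finite K" "K \<subseteq> A" "A - U \<subseteq> K" "finite ({k. {k} \<notin> U} - \<Union>K)"
  using assms unfolding psi_open_def by auto

definition psi_space :: "nat set set \<Rightarrow> nat set topology" where
  "psi_space A = topology (psi_open A)"

lemma openin_psi_space: "openin (psi_space A) = psi_open A"
proof -
  have "istopology (psi_open A)"
    unfolding istopology_def
  proof (intro conjI allI impI)
    fix S T assume S: "psi_open A S" and T: "psi_open A T"
    show "psi_open A (S \<inter> T)"
      unfolding psi_open_def
    proof (intro conjI ballI impI)
      show "S \<inter> T \<subseteq> psi_carrier A"
        using psi_open_subset[OF S] by blast
    next
      fix a assume "a \<in> A \<inter> (S \<inter> T)"
      then have "finite ({k \<in> a. {k} \<notin> S} \<union> {k \<in> a. {k} \<notin> T})"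
        using psi_open_memberD[OF S] psi_open_memberD[OF T] by simp
      then show "finite {k \<in> a. {k} \<notin> S \<inter> T}"
        by (rule rev_finite_subset) blast
    next
      assume "{} \<in> S \<inter> T"
      then have "{} \<in> S" "{} \<in> T"
        by auto
      obtain K where K: "finite K" "K \<subseteq> A" "A - S \<subseteq> K" "finite ({k. {k} \<notin> S} - \<Union>K)"
        using S \<open>{} \<in> S\<close> by (rule psi_open_infinityE)
      obtain L where L: "finite L" "L \<subseteq> A" "A - T \<subseteq> L" "finite ({k. {k} \<notin> T} - \<Union>L)"
        using T \<open>{} \<in> T\<close> by (rule psi_open_infinityE)
      have "finite ({k. {k} \<notin> S \<inter> T} - \<Union>(K \<union> L))"
        by (rule finite_subset[of _ "({k. {k} \<notin> S} - \<Union>K) \<union> ({k. {k} \<notin> T} - \<Union>L)"]) (use K(4) L(4) in auto)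
      then show "\<exists>K. finite K \<and> K \<subseteq> A \<and> A - S \<inter> T \<subseteq> K \<and> finite ({k. {k} \<notin> S \<inter> T} - \<Union>K)"
        using K(1-3) L(1-3) by (intro exI[of _ "K \<union> L"]) auto
    qed
  next
    fix \<U> assume \<U>: "\<forall>S\<in>\<U>. psi_open A S"
    show "psi_open A (\<Union>\<U>)"
      unfolding psi_open_def
    proof (intro conjI ballI impI)
      show "\<Union>\<U> \<subseteq> psi_carrier A"
        using \<U> psi_open_subset by blast
    next
      fix a assume "a \<in> A \<inter> \<Union>\<U>"
      then obtain S where S: "S \<in> \<U>" "a \<in> A \<inter> S"
        by blast
      then have "finite {k \<in> a. {k} \<notin> S}"
        using \<U> psi_open_memberD[of A S a] by simp
      then show "finite {k \<in> a. {k} \<notin> \<Union>\<U>}"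
        by (rule rev_finite_subset) (use S in blast)
    next
      assume "{} \<in> \<Union>\<U>"
      then obtain S where S: "S \<in> \<U>" "{} \<in> S"
        by blast
      then have "psi_open A S"
        using \<U> by blast
      then obtain K where K: "finite K" "K \<subseteq> A" "A - S \<subseteq> K" "finite ({k. {k} \<notin> S} - \<Union>K)"
        using S(2) by (rule psi_open_infinityE)
      have "finite ({k. {k} \<notin> \<Union>\<U>} - \<Union>K)"
        by (rule finite_subset[OF _ K(4)]) (use S in blast)
      then show "\<exists>K. finite K \<and> K \<subseteq> A \<and> A - \<Union>\<U> \<subseteq> K \<and> finite ({k. {k} \<notin> \<Union>\<U>} - \<Union>K)"
        using K(1-3) S(1) by (intro exI[of _ K]) auto
    qed
  qed
  then show ?thesis
    unfolding psi_space_def by (rule topology_inverse')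
qed

lemma topspace_psi_space: "topspace (psi_space A) = psi_carrier A"
proof -
  have "psi_open A (psi_carrier A)"
    unfolding psi_open_def psi_carrier_def by (auto intro!: exI[of _ "{}"])
  then show ?thesis
    unfolding topspace_def openin_psi_space using psi_open_subset by blast
qed

section \<open>Sequential convergence expressed by sets\<close>

text \<open>Convergence without reference to an enumeration, so that later arguments need no
  sequences. Finite sets converge to every point, hence \<open>infinite W\<close> in the criteria
  below.\<close>

definition set_converges_to :: "'a topology \<Rightarrow> 'a set \<Rightarrow> 'a \<Rightarrow> bool" where
  "set_converges_to X W p \<longleftrightarrow>
     p \<in> topspace X \<and> (\<forall>U. openin X U \<and> p \<in> U \<longrightarrow> finite (W - U))"

text \<open>The indices outside a neighbourhood \<open>U\<close> form the fibres over the finite set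
  \<open>W - U\<close>. Finite fibres, rather than injectivity, are what a subsequence of a given
  sequence provides.\<close>

lemma limitin_set_converges_to:
  fixes s :: "nat \<Rightarrow> 'a"
  assumes W: "set_converges_to X W p" and s: "\<And>i. s i \<in> W" "\<And>w. finite {i. s i = w}"
  shows "limitin X s p sequentially"
  unfolding limitin_def
proof (intro conjI allI impI)
  show "p \<in> topspace X"
    using W unfolding set_converges_to_def by blast
next
  fix U assume "openin X U \<and> p \<in> U"
  then have "finite (W - U)"
    using W unfolding set_converges_to_def by blast
  then have "finite (\<Union>w\<in>W - U. {i. s i = w})"
    using s(2) by blast
  moreover have "{i. s i \<notin> U} \<subseteq> (\<Union>w\<in>W - U. {i. s i = w})"
    using s(1) by blast
  ultimately have "finite {i. s i \<notin> U}"
    by (metis finite_subset)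
  then show "\<forall>\<^sub>F i in sequentially. s i \<in> U"
    by (simp add: cofinite_eq_sequentially[symmetric] eventually_cofinite)
qed

lemma frechet_spaceI:
  assumes "\<And>S p. S \<subseteq> topspace X \<Longrightarrow> p \<in> X closure_of S \<Longrightarrow> p \<notin> S \<Longrightarrow>
             \<exists>W\<subseteq>S. infinite W \<and> set_converges_to X W p"
  shows "frechet_space X"
  unfolding frechet_space_def
proof (intro allI impI, elim conjE)
  fix S p assume S: "S \<subseteq> topspace X" and p: "p \<in> X closure_of S"
  show "\<exists>s::nat \<Rightarrow> 'a. range s \<subseteq> S \<and> limitin X s p sequentially"
  proof (cases "p \<in> S")
    case True
    then show ?thesis
      using S by (intro exI[of _ "\<lambda>_. p"]) auto
  next
    case False
    then obtain W where W: "W \<subseteq> S" "infinite W" "set_converges_to X W p"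
      using assms S p by blast
    obtain s :: "nat \<Rightarrow> 'a" where s: "inj s" "range s \<subseteq> W"
      using infinite_countable_subset[OF W(2)] by blast
    have "finite {i. s i = w}" for w
      using finite_vimageI[OF _ s(1), of "{w}"] by (simp add: vimage_def)
    then have "limitin X s p sequentially"
      using limitin_set_converges_to[OF W(3)] s(2) by blast
    then show ?thesis
      using s(2) W(1) by blast
  qed
qed

text \<open>A sequence either takes some value infinitely often, which gives a constant subsequence,
  or has finite fibres and hence an infinite range.\<close>

lemma seq_compact_spaceI:
  assumes "\<And>V. V \<subseteq> topspace X \<Longrightarrow> infinite V \<Longrightarrow> \<exists>W\<subseteq>V. \<exists>p. infinite W \<and> set_converges_to X W p"
  shows "seq_compact_space X"
  unfolding seq_compact_space_def
proof (intro allI impI)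
  fix s :: "nat \<Rightarrow> 'a" assume s: "range s \<subseteq> topspace X"
  show "\<exists>p r. strict_mono (r::nat \<Rightarrow> nat) \<and> limitin X (s \<circ> r) p sequentially"
  proof (cases "\<exists>w. infinite {i. s i = w}")
    case True
    then obtain w where w: "infinite {i. s i = w}"
      by blast
    have "s (enumerate {i. s i = w} k) = w" for k
      using enumerate_in_set[OF w, of k] by blast
    moreover have "w \<in> topspace X"
      using s w not_finite_existsD by fastforce
    ultimately have "limitin X (s \<circ> enumerate {i. s i = w}) w sequentially"
      by (simp add: o_def)
    then show ?thesis
      using strict_mono_enumerate[OF w] by blast
  next
    case False
    then have fin: "finite {i. s i = w}" for w
      by blast
    have "infinite (range s)"
    proof
      assume "finite (range s)"
      then have "finite (\<Union>w\<in>range s. {i. s i = w})"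
        using fin by blast
      moreover have "(\<Union>w\<in>range s. {i. s i = w}) = UNIV"
        by blast
      ultimately show False
        by simp
    qed
    then obtain W p where W: "W \<subseteq> range s" "infinite W" "set_converges_to X W p"
      using assms s by blast
    have inf: "infinite {i. s i \<in> W}"
    proof
      assume "finite {i. s i \<in> W}"
      then have "finite (s ` {i. s i \<in> W})"
        by simp
      moreover have "s ` {i. s i \<in> W} = W"
        using W(1) by blast
      ultimately show False
        using W(2) by simp
    qed
    define r where "r = enumerate {i. s i \<in> W}"
    have r: "strict_mono r"
      unfolding r_def using strict_mono_enumerate[OF inf] .
    have "(s \<circ> r) k \<in> W" for k
      using enumerate_in_set[OF inf, of k] unfolding r_def by simp
    moreover have "finite {k. (s \<circ> r) k = w}" for w
      using finite_vimageI[OF fin[of w] strict_mono_imp_inj_on[OF r]] by (simp add: vimage_def)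
    ultimately have "limitin X (s \<circ> r) p sequentially"
      using limitin_set_converges_to[OF W(3)] by blast
    then show ?thesis
      using r by blast
  qed
qed

section \<open>The compactified space of an arbitrary almost disjoint family\<close>

locale ad_family =
  fixes A :: "nat set set"
  assumes ad: "almost_disjoint A"
begin

lemma infinite_member: "a \<in> A \<Longrightarrow> infinite a"
  using ad unfolding almost_disjoint_def by blast

text \<open>Keeps the three kinds of points of \<open>psi_carrier A\<close> apart.\<close>

lemma singleton_notin [simp]: "{k} \<notin> A" and empty_notin [simp]: "{} \<notin> A"
  using infinite_member by blast+

lemma open_singleton: "openin (psi_space A) {{k}}"
  unfolding openin_psi_space psi_open_def by (auto simp: psi_carrier_def)

lemma open_member:
  assumes "a \<in> A" "finite F"
  shows "openin (psi_space A) (insert a ((\<lambda>k. {k}) ` (a - F)))"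
  unfolding openin_psi_space psi_open_def
proof (intro conjI ballI impI)
  let ?U = "insert a ((\<lambda>k. {k}) ` (a - F))"
  show "?U \<subseteq> psi_carrier A"
    using assms(1) by (auto simp: psi_carrier_def)
  fix b assume "b \<in> A \<inter> ?U"
  then have "b = a"
    by auto
  then have "{k \<in> b. {k} \<notin> ?U} \<subseteq> F"
    by auto
  then show "finite {k \<in> b. {k} \<notin> ?U}"
    using assms(2) by (rule finite_subset)
next
  assume "{} \<in> insert a ((\<lambda>k. {k}) ` (a - F))"
  moreover have "{} \<noteq> a"
    using assms(1) empty_notin by metis
  ultimately have False
    by blast
  then show "\<exists>K. finite K \<and> K \<subseteq> A \<and> A - insert a ((\<lambda>k. {k}) ` (a - F)) \<subseteq> K \<and>
      finite ({k. {k} \<notin> insert a ((\<lambda>k. {k}) ` (a - F))} - \<Union>K)" ..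
qed

lemma open_infinity:
  assumes K: "finite K" "K \<subseteq> A" and T: "finite (T - \<Union>K)"
  shows "openin (psi_space A) (psi_carrier A - (K \<union> (\<lambda>k. {k}) ` T))"
  unfolding openin_psi_space psi_open_def
proof (intro conjI ballI impI)
  let ?U = "psi_carrier A - (K \<union> (\<lambda>k. {k}) ` T)"
  have out: "{k. {k} \<notin> ?U} = T"
    using K(2) by (auto simp: psi_carrier_def)
  show "?U \<subseteq> psi_carrier A"
    by blast
  show "finite {k \<in> a. {k} \<notin> ?U}" if "a \<in> A \<inter> ?U" for a
  proof -
    \<comment> \<open>A member outside \<open>K\<close> meets \<open>\<Union>K\<close> in a finite
      set, so it loses only finitely many of its naturals.\<close>
    have "finite (a \<inter> \<Union>K)"
      using that by (intro finite_Int_Union[OF ad _ K(2,1)]) auto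
    moreover have "{k \<in> a. {k} \<notin> ?U} \<subseteq> (a \<inter> \<Union>K) \<union> (T - \<Union>K)"
      using out by blast
    ultimately show ?thesis
      using T by (meson finite_UnI finite_subset)
  qed
  show "\<exists>L. finite L \<and> L \<subseteq> A \<and> A - ?U \<subseteq> L \<and> finite ({k. {k} \<notin> ?U} - \<Union>L)"
    unfolding out using K T by (intro exI[of _ K]) (auto simp: psi_carrier_def)
qed

lemma set_converges_to_infinity_members:
  assumes "W \<subseteq> A"
  shows "set_converges_to (psi_space A) W {}"
  unfolding set_converges_to_def
proof (intro conjI allI impI)
  show "{} \<in> topspace (psi_space A)"
    by (simp add: topspace_psi_space psi_carrier_def)
next
  fix U assume "openin (psi_space A) U \<and> {} \<in> U"
  then have "psi_open A U" "{} \<in> U"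
    by (simp_all add: openin_psi_space)
  then obtain K where "finite K" "A - U \<subseteq> K"
    by (rule psi_open_infinityE)
  show "finite (W - U)"
    by (rule finite_subset[OF _ \<open>finite K\<close>]) (use assms \<open>A - U \<subseteq> K\<close> in blast)
qed

text \<open>The naturals missed by a neighbourhood of infinity lie almost inside finitely many
  members, each of which meets \<open>Z\<close> in a finite set.\<close>

lemma set_converges_to_infinity_orthogonal:
  assumes Z: "orthogonal_to A Z"
  shows "set_converges_to (psi_space A) ((\<lambda>k. {k}) ` Z) {}"
  unfolding set_converges_to_def
proof (intro conjI allI impI)
  show "{} \<in> topspace (psi_space A)"
    by (simp add: topspace_psi_space psi_carrier_def)
next
  fix U assume "openin (psi_space A) U \<and> {} \<in> U"
  then have "psi_open A U" "{} \<in> U"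
    by (simp_all add: openin_psi_space)
  then obtain K where K: "finite K" "K \<subseteq> A" "finite ({k. {k} \<notin> U} - \<Union>K)"
    by (rule psi_open_infinityE)
  have "finite (\<Union>a\<in>K. a \<inter> Z)"
    using K Z unfolding orthogonal_to_def by blast
  then have "finite ((\<lambda>k. {k}) ` ((\<Union>a\<in>K. a \<inter> Z) \<union> ({k. {k} \<notin> U} - \<Union>K)))"
    using K(3) by blast
  then show "finite ((\<lambda>k. {k}) ` Z - U)"
    by (rule rev_finite_subset) blast
qed

lemma set_converges_to_member:
  assumes a: "a \<in> A" and Z: "Z \<subseteq> a"
  shows "set_converges_to (psi_space A) ((\<lambda>k. {k}) ` Z) a"
  unfolding set_converges_to_def
proof (intro conjI allI impI)
  show "a \<in> topspace (psi_space A)"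
    using a by (simp add: topspace_psi_space psi_carrier_def)
next
  fix U assume "openin (psi_space A) U \<and> a \<in> U"
  then have "finite ((\<lambda>k. {k}) ` {k \<in> a. {k} \<notin> U})"
    using a psi_open_memberD[of A U a] by (simp add: openin_psi_space)
  then show "finite ((\<lambda>k. {k}) ` Z - U)"
    by (rule rev_finite_subset) (use Z in blast)
qed

text \<open>One pair of neighbourhoods for each pair of kinds of points. A member \<open>a\<close>
  together with its naturals is clopen, which separates it from infinity; two members are separated
  by dropping their finite intersection.\<close>

lemma Hausdorff_psi_space: "Hausdorff_space (psi_space A)"
proof -
  define sep where "sep x y \<longleftrightarrow>
      (\<exists>U V. openin (psi_space A) U \<and> openin (psi_space A) V \<and> x \<in> U \<and> y \<in> V \<and> disjnt U V)" for x y
  have sym: "sep y x" if "sep x y" for x y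
    using that disjnt_sym unfolding sep_def by blast
  have inf_num: "sep {} {k}" for k
    unfolding sep_def using open_infinity[of "{}" "{k}"] open_singleton[of k]
    by (intro exI[of _ "psi_carrier A - {{k}}"] exI[of _ "{{k}}"])
      (auto simp: psi_carrier_def disjnt_def)
  have inf_mem: "sep {} a" if a: "a \<in> A" for a
  unfolding sep_def
  proof (intro exI conjI)
    show "openin (psi_space A) (psi_carrier A - ({a} \<union> (\<lambda>k. {k}) ` a))"
      using a by (intro open_infinity) auto
    show "openin (psi_space A) (insert a ((\<lambda>k. {k}) ` (a - {})))"
      using a by (intro open_member) auto
  qed (use a in \<open>auto simp: psi_carrier_def disjnt_def\<close>)
  have num_num: "sep {k} {l}" if "k \<noteq> l" for k l
    unfolding sep_def using that open_singleton[of k] open_singleton[of l]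
    by (intro exI[of _ "{{k}}"] exI[of _ "{{l}}"]) (auto simp: disjnt_def)
  have num_mem: "sep {k} a" if a: "a \<in> A" for k a
  unfolding sep_def
  proof (intro exI conjI)
    show "openin (psi_space A) {{k}}"
      by (rule open_singleton)
    show "openin (psi_space A) (insert a ((\<lambda>k. {k}) ` (a - {k})))"
      using a by (intro open_member) auto
  qed (use a in \<open>auto simp: disjnt_def\<close>)
  have mem_mem: "sep a b" if ab: "a \<in> A" "b \<in> A" "a \<noteq> b" for a b
  unfolding sep_def
  proof (intro exI conjI)
    have "finite (a \<inter> b)"
      using ab ad unfolding almost_disjoint_def by blast
    then show "openin (psi_space A) (insert a ((\<lambda>k. {k}) ` (a - (a \<inter> b))))"
      and "openin (psi_space A) (insert b ((\<lambda>k. {k}) ` (b - (a \<inter> b))))"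
      using ab by (auto intro!: open_member simp del: Diff_Int)
  qed (use ab in \<open>auto simp: disjnt_def\<close>)
  have "sep x y" if "x \<in> psi_carrier A" "y \<in> psi_carrier A" "x \<noteq> y" for x y
  proof -
    have "x = {} \<or> (\<exists>k. x = {k}) \<or> x \<in> A" "y = {} \<or> (\<exists>k. y = {k}) \<or> y \<in> A"
      using that by (auto simp: psi_carrier_def)
    then show ?thesis
      using that(3) by (elim disjE exE) (auto intro: inf_num inf_mem num_num num_mem mem_mem
          sym[OF inf_num] sym[OF inf_mem] sym[OF num_mem])
  qed
  then show ?thesis
    unfolding Hausdorff_space_def topspace_psi_space sep_def by blast
qed

text \<open>Infinitely many members converge to infinity. Failing that, there are infinitely many
  naturals: either they are orthogonal to \<open>A\<close> and converge to infinity, or some member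
  catches infinitely many of them and is their limit.\<close>

lemma seq_compact_psi_space: "seq_compact_space (psi_space A)"
proof (rule seq_compact_spaceI)
  fix V assume V: "V \<subseteq> topspace (psi_space A)" "infinite V"
  show "\<exists>W\<subseteq>V. \<exists>p. infinite W \<and> set_converges_to (psi_space A) W p"
  proof (cases "infinite (V \<inter> A)")
    case True
    then show ?thesis
      using set_converges_to_infinity_members[of "V \<inter> A"] by blast
  next
    case False
    define Z where "Z = {k. {k} \<in> V}"
    have "V \<subseteq> {{}} \<union> (V \<inter> A) \<union> (\<lambda>k. {k}) ` Z"
      using V(1) unfolding Z_def topspace_psi_space psi_carrier_def by blast
    then have "infinite Z"
      using False V(2) by (meson finite.emptyI finite.insertI finite_UnI finite_imageI finite_subset)
    have "\<exists>Y\<subseteq>Z. \<exists>p. infinite Y \<and> set_converges_to (psi_space A) ((\<lambda>k. {k}) ` Y) p"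
    proof (cases "orthogonal_to A Z")
      case True
      then show ?thesis
        using \<open>infinite Z\<close> set_converges_to_infinity_orthogonal by blast
    next
      case False
      then obtain a where "a \<in> A" "infinite (a \<inter> Z)"
        unfolding orthogonal_to_def by blast
      then show ?thesis
        using set_converges_to_member[of a "a \<inter> Z"] by blast
    qed
    then obtain Y p where Y: "Y \<subseteq> Z" "infinite Y" "set_converges_to (psi_space A) ((\<lambda>k. {k}) ` Y) p"
      by blast
    have "infinite ((\<lambda>k. {k}) ` Y)"
      using Y(2) by (simp add: finite_image_iff)
    moreover have "(\<lambda>k. {k}) ` Y \<subseteq> V"
      using Y(1) unfolding Z_def by blast
    ultimately show ?thesis
      using Y(3) by blast
  qed
qed

lemma frechet_psi_space:
  assumes cover: "\<And>S. (\<And>Z. Z \<subseteq> S \<Longrightarrow> orthogonal_to A Z \<Longrightarrow> finite Z) \<Longrightarrow>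
                    \<exists>K\<subseteq>A. finite K \<and> finite (S - \<Union>K)"
  shows "frechet_space (psi_space A)"
proof (rule frechet_spaceI)
  fix S p
  assume "S \<subseteq> topspace (psi_space A)" and p: "p \<in> psi_space A closure_of S" "p \<notin> S"
  define T where "T = {k. {k} \<in> S}"
  have inf_img: "infinite ((\<lambda>k. {k}) ` Z)" if "infinite Z" for Z :: "nat set"
    using that by (simp add: finite_image_iff)
  have meets: "U \<inter> S \<noteq> {}" if "openin (psi_space A) U" "p \<in> U" for U
    using p(1) that unfolding in_closure_of by blast
  have "p \<in> psi_carrier A"
    using p(1) by (simp add: in_closure_of topspace_psi_space)
  then consider k where "p = {k}" | "p \<in> A" | "p = {}"
    by (auto simp: psi_carrier_def)
  then show "\<exists>W\<subseteq>S. infinite W \<and> set_converges_to (psi_space A) W p"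
  proof cases
    case 1
    then show ?thesis
      using meets[OF open_singleton] p(2) by blast
  next
    case 2
    \<comment> \<open>Otherwise \<open>p\<close> with the naturals in \<open>p - T\<close> would be
      a neighbourhood of \<open>p\<close> that misses \<open>S\<close>.\<close>
    have "infinite (p \<inter> T)"
      using meets[OF open_member[OF 2, of "p \<inter> T"]] p(2) unfolding T_def by blast
    moreover have "(\<lambda>k. {k}) ` (p \<inter> T) \<subseteq> S"
      unfolding T_def by blast
    ultimately show ?thesis
      using inf_img set_converges_to_member[OF 2, of "p \<inter> T"] by blast
  next
    case 3
    show ?thesis
    proof (rule ccontr)
      assume none: "\<not> ?thesis"
      have "finite Z" if "Z \<subseteq> T" "orthogonal_to A Z" for Z
      proof (rule ccontr)
        assume "infinite Z"
        moreover have "(\<lambda>k. {k}) ` Z \<subseteq> S"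
          using that(1) unfolding T_def by blast
        ultimately show False
          using none 3 inf_img set_converges_to_infinity_orthogonal[OF that(2)] by blast
      qed
      then obtain K where K: "K \<subseteq> A" "finite K" "finite (T - \<Union>K)"
        using cover by blast
      have "finite (S \<inter> A)"
        using none 3 set_converges_to_infinity_members[of "S \<inter> A"] by blast
      moreover have "finite (T - \<Union>(K \<union> (S \<inter> A)))"
        by (rule finite_subset[OF _ K(3)]) blast
      \<comment> \<open>The members in \<open>S\<close> are finitely many and its naturals are
        almost covered, so removing all of them leaves a neighbourhood of infinity.\<close>
      ultimately have "openin (psi_space A) (psi_carrier A - ((K \<union> (S \<inter> A)) \<union> (\<lambda>k. {k}) ` T))"
        using K by (intro open_infinity) auto
      moreover have "p \<in> psi_carrier A - ((K \<union> (S \<inter> A)) \<union> (\<lambda>k. {k}) ` T)"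
        using 3 K(1) by (auto simp: psi_carrier_def)
      ultimately have "(psi_carrier A - ((K \<union> (S \<inter> A)) \<union> (\<lambda>k. {k}) ` T)) \<inter> S \<noteq> {}"
        by (rule meets)
      then show False
        using p(2) 3 unfolding T_def psi_carrier_def by blast
    qed
  qed
qed

end

section \<open>The example\<close>

theorem theorem28:
  shows "\<exists>X :: nat set topology.
           Hausdorff_space X \<and> frechet_space X \<and> seq_compact_space X \<and>
           \<not> n_seq_compact_space 2 X"
proof -
  obtain M where "mad_family M" and Minf: "infinite M"
    using mad_family_exists by blast
  then interpret mad_family M
    by simp
  obtain d X where pos: "infinite (traces M X)"
    and nowhere: "\<And>Y i. Y \<subseteq> X \<Longrightarrow> infinite (traces M Y) \<Longrightarrow>
          \<exists>Z\<subseteq>Y. infinite Z \<and> orthogonal_to {a \<in> M. (d \<in> a) = i} Z"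
    using nowhere_maximal_partition[OF Minf] by blast
  \<comment> \<open>Cutting down to \<open>X\<close> makes every set outside \<open>X\<close>
    orthogonal to \<open>A\<close>.\<close>
  define A where "A = (\<lambda>a. a \<inter> X) ` {a \<in> traces M X. d \<in> a}"
  have finite_Int: "finite (a \<inter> b)" if "a \<in> M" "b \<in> M" "a \<noteq> b" for a b
    using ad that unfolding almost_disjoint_def by blast
  have "almost_disjoint A"
    unfolding almost_disjoint_def
  proof (intro conjI ballI impI)
    fix a assume "a \<in> A"
    then show "infinite a"
      unfolding A_def traces_def by blast
  next
    fix a b assume "a \<in> A" "b \<in> A" "a \<noteq> b"
    then obtain a' b' where ab: "a = a' \<inter> X" "b = b' \<inter> X" "a' \<in> M" "b' \<in> M" "a' \<noteq> b'"
      unfolding A_def traces_def by blast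
    show "finite (a \<inter> b)"
      by (rule finite_subset[OF _ finite_Int[OF ab(3-5)]]) (use ab in blast)
  qed
  then interpret psi: ad_family A
    by unfold_locales
  have orth_A: "orthogonal_to A Z" if Z: "orthogonal_to {a \<in> M. d \<in> a} Z" for Z
    unfolding orthogonal_to_def
  proof
    fix a assume "a \<in> A"
    then obtain b where b: "a = b \<inter> X" "b \<in> M" "d \<in> b"
      unfolding A_def traces_def by blast
    then have "finite (b \<inter> Z)"
      using Z unfolding orthogonal_to_def by blast
    then show "finite (a \<inter> Z)"
      by (rule rev_finite_subset) (use b in blast)
  qed
  \<comment> \<open>Since the half with \<open>d\<close> is not maximal below positive subsets of
    \<open>X\<close>, only finitely many members have infinite trace on \<open>S \<inter> X\<close>;
    by maximality of \<open>M\<close> they almost cover it.\<close>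
  have cover: "\<exists>K\<subseteq>A. finite K \<and> finite (S - \<Union>K)"
    if S: "\<And>Z. Z \<subseteq> S \<Longrightarrow> orthogonal_to A Z \<Longrightarrow> finite Z" for S
  proof -
    have "orthogonal_to A (S - X)"
      unfolding orthogonal_to_def A_def by (auto simp: Int_assoc)
    then have SX: "finite (S - X)"
      using S by blast
    let ?H = "traces M (S \<inter> X)"
    have "finite ?H"
    proof (rule ccontr)
      assume "infinite ?H"
      then obtain Z where "Z \<subseteq> S \<inter> X" "infinite Z" "orthogonal_to {a \<in> M. (d \<in> a) = True} Z"
        using nowhere[of "S \<inter> X" True] by blast
      then show False
        using S[of Z] orth_A[of Z] by simp
    qed
    \<comment> \<open>Without \<open>d\<close> in \<open>a\<close>, the trace of \<open>a\<close>
      would itself be an infinite set orthogonal to \<open>A\<close>.\<close>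
    have bit: "d \<in> a" if a: "a \<in> ?H" for a
    proof (rule ccontr)
      assume "d \<notin> a"
      have "orthogonal_to {b \<in> M. d \<in> b} (a \<inter> (S \<inter> X))"
        unfolding orthogonal_to_def
      proof
        fix b assume "b \<in> {b \<in> M. d \<in> b}"
        then have "finite (b \<inter> a)"
          using a \<open>d \<notin> a\<close> finite_Int unfolding traces_def by blast
        then show "finite (b \<inter> (a \<inter> (S \<inter> X)))"
          by (rule rev_finite_subset) blast
      qed
      then show False
        using S[of "a \<inter> (S \<inter> X)"] orth_A a unfolding traces_def by blast
    qed
    have "orthogonal_to M (S \<inter> X - \<Union>?H)"
      unfolding orthogonal_to_def
    proof
      fix a assume "a \<in> M"
      show "finite (a \<inter> (S \<inter> X - \<Union>?H))"
      proof (cases "a \<in> ?H")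
        case True
        then have "a \<inter> (S \<inter> X - \<Union>?H) = {}"
          by blast
        then show ?thesis
          by simp
      next
        case False
        then have "finite (a \<inter> (S \<inter> X))"
          using \<open>a \<in> M\<close> unfolding traces_def by blast
        then show ?thesis
          by (rule rev_finite_subset) blast
      qed
    qed
    then have "finite ((S - X) \<union> (S \<inter> X - \<Union>?H))"
      using SX maximal by blast
    then have "finite (S - \<Union>((\<lambda>a. a \<inter> X) ` ?H))"
      by (rule rev_finite_subset) blast
    moreover have "(\<lambda>a. a \<inter> X) ` ?H \<subseteq> A"
    proof
      fix x assume "x \<in> (\<lambda>a. a \<inter> X) ` ?H"
      then obtain a where a: "x = a \<inter> X" "a \<in> ?H"
        by blast
      then have "infinite (a \<inter> (S \<inter> X))"
        by (simp add: traces_def)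
      then have "infinite (a \<inter> X)"
        by (rule infinite_super[rotated]) blast
      then show "x \<in> A"
        using a bit unfolding A_def traces_def by blast
    qed
    ultimately show ?thesis
      using \<open>finite ?H\<close> by blast
  qed
  obtain c :: "nat \<Rightarrow> nat set" where c: "inj c" "range c \<subseteq> traces M X"
    using infinite_countable_subset[OF pos] by blast
  have cM: "c n \<in> M" and cX: "infinite (c n \<inter> X)" for n
    using c(2) unfolding traces_def by auto
  \<comment> \<open>For \<open>e = {n, m}\<close> with \<open>n < m\<close>, the minimum selects the
    member and the maximum the position in its trace.\<close>
  define g where "g e = enumerate (c (Min e) \<inter> X) (Max e)" for e
  have gX: "g e \<in> X" for e
    using enumerate_in_set[OF cX] unfolding g_def by blast
  \<comment> \<open>With the minimum fixed at \<open>n\<close>, the elements of \<open>B\<close>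
    above \<open>n\<close> already give infinitely many points of \<open>c n\<close>.\<close>
  have g_trace: "infinite (c n \<inter> g ` [B]\<^bsup>2\<^esup>)" if B: "infinite B" "n \<in> B" for B n
  proof -
    have "infinite (B - {..n})"
      using B(1) by simp
    moreover have "inj_on (enumerate (c n \<inter> X)) (B - {..n})"
      using inj_on_subset[OF strict_mono_imp_inj_on[OF strict_mono_enumerate[OF cX]] subset_UNIV] .
    ultimately have "infinite (enumerate (c n \<inter> X) ` (B - {..n}))"
      by (simp add: finite_image_iff)
    moreover have "enumerate (c n \<inter> X) ` (B - {..n}) \<subseteq> c n \<inter> g ` [B]\<^bsup>2\<^esup>"
    proof
      fix y assume "y \<in> enumerate (c n \<inter> X) ` (B - {..n})"
      then obtain m where "m \<in> B - {..n}" "y = enumerate (c n \<inter> X) m"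
        by blast
      then have m: "m \<in> B" "n < m" "y = enumerate (c n \<inter> X) m"
        by auto
      then have "{n, m} \<in> [B]\<^bsup>2\<^esup>" "g {n, m} = y"
        using B(2) unfolding nsets_def g_def by auto
      moreover have "y \<in> c n"
        using enumerate_in_set[OF cX[of n], of m] m(3) by simp
      ultimately show "y \<in> c n \<inter> g ` [B]\<^bsup>2\<^esup>"
        by (metis IntI imageI)
    qed
    ultimately show ?thesis
      by (metis finite_subset)
  qed
  have "\<not> nsets_converges_to (psi_space A) 2 B (\<lambda>e. {g e}) p" if B: "infinite B" for B p
  proof
    assume conv: "nsets_converges_to (psi_space A) 2 B (\<lambda>e. {g e}) p"
    have tail: "\<exists>F. finite F \<and> (\<forall>k \<in> g ` [B - F]\<^bsup>2\<^esup>. {k} \<in> U)"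
      if U: "openin (psi_space A) U" "p \<in> U" for U
    proof -
      have "\<exists>F. finite F \<and> F \<subseteq> B \<and> (\<lambda>e. {g e}) ` [B - F]\<^bsup>2\<^esup> \<subseteq> U"
        using conv U unfolding nsets_converges_to_def by simp
      then show ?thesis
        by (metis (no_types, lifting) image_eqI imageE subsetD)
    qed
    have "p \<in> psi_carrier A"
      using conv unfolding nsets_converges_to_def topspace_psi_space by simp
    then consider k where "p = {k}" | "p \<in> A" | "p = {}"
      by (auto simp: psi_carrier_def)
    then show False
    proof cases
      case 1
      \<comment> \<open>All late values would equal \<open>k\<close>, although one fixed minimum
        already produces infinitely many.\<close>
      then obtain F where F: "finite F" "\<forall>j \<in> g ` [B - F]\<^bsup>2\<^esup>. {j} \<in> {{k}}"
        using tail[OF psi.open_singleton] by blast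
      have "infinite (B - F)"
        using B F(1) by simp
      then obtain n where "n \<in> B - F"
        using infinite_imp_nonempty by blast
      then have "infinite (c n \<inter> g ` [B - F]\<^bsup>2\<^esup>)"
        using g_trace \<open>infinite (B - F)\<close> by blast
      moreover have "c n \<inter> g ` [B - F]\<^bsup>2\<^esup> \<subseteq> {k}"
        using F(2) by auto
      ultimately show False
        by (metis finite.emptyI finite.insertI finite_subset)
    next
      case 2
      then obtain a where a: "a \<in> M" "p = a \<inter> X"
        unfolding A_def traces_def by blast
      \<comment> \<open>All late values would lie in \<open>p\<close>, hence in the single member
        \<open>a\<close>, and some \<open>c n\<close> other than \<open>a\<close> would meet
        \<open>a\<close> in an infinite set.\<close>
      obtain F where F: "finite F" "\<forall>k \<in> g ` [B - F]\<^bsup>2\<^esup>. {k} \<in> insert p ((\<lambda>k. {k}) ` (p - {}))"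
        using tail[OF psi.open_member[OF 2, of "{}"]] by blast
      have sub: "g ` [B - F]\<^bsup>2\<^esup> \<subseteq> p"
      proof
        fix k assume "k \<in> g ` [B - F]\<^bsup>2\<^esup>"
        then have "{k} = p \<or> k \<in> p"
          using F(2) by auto
        then show "k \<in> p"
          using 2 psi.singleton_notin by metis
      qed
      have BF: "infinite (B - F)"
        using B F(1) by simp
      have "finite {n. c n = a}"
        using finite_vimageI[OF _ c(1), of "{a}"] by (simp add: vimage_def)
      then have "\<not> B - F \<subseteq> {n. c n = a}"
        using BF by (metis finite_subset)
      then obtain n where n: "n \<in> B - F" "c n \<noteq> a"
        by blast
      have "c n \<inter> g ` [B - F]\<^bsup>2\<^esup> \<subseteq> c n \<inter> a"
        using sub a(2) by blast
      then show False
        using g_trace[OF BF n(1)] finite_Int[OF cM a(1) n(2)] by (metis finite_subset)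
    next
      case 3
      \<comment> \<open>The values on the tails of \<open>B\<close>; each tail still meets
        infinitely many of the \<open>c k\<close> in infinite sets.\<close>
      define P where "P n = g ` [B - {..<n}]\<^bsup>2\<^esup>" for n
      have "decseq P"
        unfolding decseq_def P_def by (intro allI impI image_mono nsets_mono) auto
      moreover have "infinite (traces M (P n))" for n
      proof -
        have Bn: "infinite (B - {..<n})"
          using B by simp
        have "c ` (B - {..<n}) \<subseteq> traces M (P n)"
          using g_trace[OF Bn] cM unfolding traces_def P_def by blast
        moreover have "infinite (c ` (B - {..<n}))"
          using Bn inj_on_subset[OF c(1) subset_UNIV] by (simp add: finite_image_iff)
        ultimately show ?thesis
          by (metis finite_subset)
      qed
      ultimately obtain Y where Y: "infinite (traces M Y)" "\<And>n. finite (Y - P n)"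
        using infinite_traces_pseudo_intersection by blast
      have PX: "P n \<subseteq> X" for n
        using gX unfolding P_def by blast
      \<comment> \<open>Convergence to infinity makes some \<open>P n\<close> avoid a given
        \<open>a \<inter> X\<close> in \<open>A\<close>, and \<open>Y\<close> lies almost inside
        \<open>P n\<close>.\<close>
      have orth_Y: "orthogonal_to {a \<in> M. d \<in> a} (Y \<inter> X)"
        unfolding orthogonal_to_def
      proof
        fix a assume a: "a \<in> {a \<in> M. d \<in> a}"
        show "finite (a \<inter> (Y \<inter> X))"
        proof (cases "a \<in> traces M X")
          case True
          then have aX: "a \<inter> X \<in> A"
            using a unfolding A_def by blast
          have nbhd: "openin (psi_space A) (psi_carrier A - ({a \<inter> X} \<union> (\<lambda>k. {k}) ` (a \<inter> X)))"
            using aX by (intro psi.open_infinity) auto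
          have "a \<inter> X \<noteq> {}"
            using aX psi.empty_notin by metis
          then have p: "p \<in> psi_carrier A - ({a \<inter> X} \<union> (\<lambda>k. {k}) ` (a \<inter> X))"
            using 3 by (auto simp: psi_carrier_def)
          obtain F where F: "finite F"
              "\<forall>k \<in> g ` [B - F]\<^bsup>2\<^esup>. {k} \<in> psi_carrier A - ({a \<inter> X} \<union> (\<lambda>k. {k}) ` (a \<inter> X))"
            using tail[OF nbhd p] by blast
          obtain n where "F \<subseteq> {..<n}"
            using F(1) finite_nat_iff_bounded by blast
          then have "P n \<subseteq> g ` [B - F]\<^bsup>2\<^esup>"
            unfolding P_def by (intro image_mono nsets_mono) blast
          moreover have "k \<notin> a \<inter> X" if "k \<in> g ` [B - F]\<^bsup>2\<^esup>" for k
            using F(2) that by blast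
          ultimately have "a \<inter> (Y \<inter> X) \<subseteq> Y - P n"
            by blast
          then show ?thesis
            using Y(2) by (rule finite_subset)
        next
          case False
          then have "finite (a \<inter> X)"
            using a unfolding traces_def by blast
          then show ?thesis
            by (rule rev_finite_subset) blast
        qed
      qed
      \<comment> \<open>\<open>Y\<close> lies almost inside \<open>P 0\<close> and hence inside
        \<open>X\<close>, so cutting down to \<open>X\<close> loses no trace.\<close>
      have "traces M Y \<subseteq> traces M (Y \<inter> X)"
      proof
        fix a assume a: "a \<in> traces M Y"
        then have "infinite (a \<inter> Y)"
          by (simp add: traces_def)
        then have "infinite (a \<inter> (Y \<inter> X))"
          by (rule infinite_remainder[OF _ Y(2)[of 0]]) (use PX[of 0] in blast)
        then show "a \<in> traces M (Y \<inter> X)"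
          using a by (simp add: traces_def)
      qed
      then have "infinite (traces M (Y \<inter> X))"
        using Y(1) by (rule infinite_super)
      then obtain Z where Z: "Z \<subseteq> Y \<inter> X" "infinite Z" "orthogonal_to {a \<in> M. (d \<in> a) = False} Z"
        using nowhere[of "Y \<inter> X" False] by blast
      \<comment> \<open>The half with \<open>d\<close> is handled by \<open>orth_Y\<close>, the half
        without \<open>d\<close> by the choice of \<open>Z\<close>.\<close>
      have "orthogonal_to M Z"
        using Z(3) orthogonal_to_subset[OF orth_Y Z(1)] unfolding orthogonal_to_def by blast
      then show False
        using Z(2) maximal by blast
    qed
  qed
  moreover have "(\<lambda>e. {g e}) \<in> [UNIV :: nat set]\<^bsup>2\<^esup> \<rightarrow> topspace (psi_space A)"
    by (simp add: topspace_psi_space psi_carrier_def)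
  ultimately have "\<not> n_seq_compact_space 2 (psi_space A)"
    unfolding n_seq_compact_space_def nsets_convergent_def by blast
  then show ?thesis
    using psi.Hausdorff_psi_space psi.seq_compact_psi_space psi.frechet_psi_space[OF cover] by blast
qed

end
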